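(* Let $G$ be a finite abelian group and $n\ge 2$ an integer. The assignment on symbols $$[a_1,\dots,a_n]\mapsto\langle a_1,\dots,a_n\rangle\quad\text{if all } a_1,\dots,a_n\neq 0,$$ $$[0,a_2,\dots,a_n]\mapsto 2\langle 0,a_2,\dots,a_n\rangle\quad\text{if all } a_2,\dots,a_n\ne 0,$$ $$[0,0,a_3,\dots,a_n]\mapsto 0\quad\text{for all } a_3,\dots,a_n,$$ extended by $\mathbb Z$-linearity (and compatibly with permutations of entries), gives a well-defined homomorphism $\mu:\mathcal B_n(G)\to\mathcal M_n(G)$, and $\mu$ is a surjection modulo $2$-torsion, i.e. its cokernel is annihilated by $2$.
   Context: Let $A=\mathrm{Hom}(G,\mathbb C^\times)$ be the group of characters of $G$, written additively. The group $\mathcal B_n(G)$ is the $\mathbb Z$-module generated by symbols $[a_1,\dots,a_n]$ with $a_i\in A$ such that $\sum_i\mathbb Z a_i=A$, subject to the relations: (S) for all permutations $\sigma\in\mathfrak S_n$: $[a_{\sigma(1)},\dots,a_{\sigma(n)}]=[a_1,\dots,a_n]$; (B) for all $2\le k\le n$, all $a_1,\dots,a_k\in A$ and all $b_1,\dots,b_{n-k}\in A$ with $\sum_i\mathbb Z a_i+\sum_j\mathbb Z b_j=A$: $$[a_1,\dots,a_k,b_1,\dots,b_{n-k}]=\sum_{\substack{1\le i\le k\\ a_i\ne a_{i'}\ \forall i'<i}}[a_1-a_i,\dots,a_i,\dots,a_k-a_i,b_1,\dots,b_{n-k}],$$ where in the $i$-th summand the $i$-th entry is $a_i$ and for $j\le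 k$, $j\ne i$, the $j$-th entry is $a_j-a_i$. The group $\mathcal M_n(G)$ is the $\mathbb Z$-module generated by symbols $\langle a_1,\dots,a_n\rangle$ with $a_i\in A$ such that $\sum_i\mathbb Z a_i=A$, subject to the relations: (S) $\langle a_{\sigma(1)},\dots,a_{\sigma(n)}\rangle=\langle a_1,\dots,a_n\rangle$ for all $\sigma\in\mathfrak S_n$; (M) for all $2\le k\le n$, all $a_1,\dots,a_k\in A$ and all $b_1,\dots,b_{n-k}\in A$ with $\sum_i\mathbb Z a_i+\sum_j\mathbb Z b_j=A$: $$\langle a_1,\dots,a_k,b_1,\dots,b_{n-k}\rangle=\sum_{1\le i\le k}\langle a_1-a_i,\dots,a_i,\dots,a_k-a_i,b_1,\dots,b_{n-k}\rangle,$$ where again in the $i$-th summand the $i$-th entry is $a_i$ and for $j\le k$, $j\neq i$, the $j$-th entry is $a_j-a_i$ (the sum is over all $i$, without any distinctness condition). *)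

theory Defs
  imports Complex_Main "HOL-Algebra.Free_Abelian_Groups" "HOL-Combinatorics.Permutations"
begin

definition complex_units :: "complex monoid" where
  "complex_units = \<lparr>carrier = - {0}, monoid.mult = (*), one = 1\<rparr>"

text \<open>The group of characters of \<open>G\<close>. Characters are cut off outside \<open>carrier G\<close>, so that
  equality in HOL is equality of characters.\<close>

definition character_group :: "('g, 'm) monoid_scheme \<Rightarrow> ('g \<Rightarrow> complex) monoid" where
  "character_group G =
     \<lparr>carrier = hom G complex_units \<inter> extensional (carrier G),
      monoid.mult = (\<lambda>\<chi> \<psi>. \<lambda>g\<in>carrier G. \<chi> g * \<psi> g),
      one = (\<lambda>g\<in>carrier G. 1)\<rparr>"

text \<open>The symbol groups depend only on the abelian group \<open>A\<close> (the character group in the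
  application). \<open>A\<close> is a HOL-Algebra group and hence written multiplicatively:
  \<open>a \<otimes>\<^bsub>A\<^esub> inv\<^bsub>A\<^esub> b\<close> stands for \<open>a - b\<close>, and \<open>\<one>\<^bsub>A\<^esub>\<close> for \<open>0\<close>.\<close>

definition symbols :: "('a, 'm) monoid_scheme \<Rightarrow> nat \<Rightarrow> 'a list set" where
  "symbols A n = {xs. length xs = n \<and> set xs \<subseteq> carrier A \<and> generate A (set xs) = carrier A}"

text \<open>From \<open>a\<^sub>1, \<dots>, a\<^sub>k\<close> to \<open>a\<^sub>1 - a\<^sub>i, \<dots>, a\<^sub>i, \<dots>, a\<^sub>k - a\<^sub>i\<close>; indices start at \<open>0\<close>.\<close>

definition pivot :: "('a, 'm) monoid_scheme \<Rightarrow> 'a list \<Rightarrow> nat \<Rightarrow> 'a list" where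
  "pivot A as i = (map (\<lambda>x. x \<otimes>\<^bsub>A\<^esub> inv\<^bsub>A\<^esub> (as ! i)) as)[i := as ! i]"

text \<open>A relation \<open>u = v\<close> is represented by the element \<open>u - v\<close> of the free abelian group.\<close>

definition S_relators :: "('a, 'm) monoid_scheme \<Rightarrow> nat \<Rightarrow> ('a list \<Rightarrow>\<^sub>0 int) set" where
  "S_relators A n =
     {frag_of (permute_list \<sigma> xs) - frag_of xs | \<sigma> xs. \<sigma> permutes {..<n} \<and> xs \<in> symbols A n}"

definition B_relators :: "('a, 'm) monoid_scheme \<Rightarrow> nat \<Rightarrow> ('a list \<Rightarrow>\<^sub>0 int) set" where
  "B_relators A n =
     {frag_of (as @ bs)
        - (\<Sum>i | i < length as \<and> (\<forall>i'<i. as ! i \<noteq> as ! i'). frag_of (pivot A as i @ bs)) | as bs.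
      2 \<le> length as \<and> as @ bs \<in> symbols A n}"

definition M_relators :: "('a, 'm) monoid_scheme \<Rightarrow> nat \<Rightarrow> ('a list \<Rightarrow>\<^sub>0 int) set" where
  "M_relators A n =
     {frag_of (as @ bs) - (\<Sum>i<length as. frag_of (pivot A as i @ bs)) | as bs.
      2 \<le> length as \<and> as @ bs \<in> symbols A n}"

definition B_kernel :: "('a, 'm) monoid_scheme \<Rightarrow> nat \<Rightarrow> ('a list \<Rightarrow>\<^sub>0 int) set" where
  "B_kernel A n =
     generate (free_Abelian_group (symbols A n)) (S_relators A n \<union> B_relators A n)"

definition M_kernel :: "('a, 'm) monoid_scheme \<Rightarrow> nat \<Rightarrow> ('a list \<Rightarrow>\<^sub>0 int) set" where
  "M_kernel A n =
     generate (free_Abelian_group (symbols A n)) (S_relators A n \<union> M_relators A n)"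

definition B_group :: "('a, 'm) monoid_scheme \<Rightarrow> nat \<Rightarrow> ('a list \<Rightarrow>\<^sub>0 int) set monoid" where
  "B_group A n = free_Abelian_group (symbols A n) Mod B_kernel A n"

definition M_group :: "('a, 'm) monoid_scheme \<Rightarrow> nat \<Rightarrow> ('a list \<Rightarrow>\<^sub>0 int) set monoid" where
  "M_group A n = free_Abelian_group (symbols A n) Mod M_kernel A n"

definition B_symbol ::
    "('a, 'm) monoid_scheme \<Rightarrow> nat \<Rightarrow> 'a list \<Rightarrow> ('a list \<Rightarrow>\<^sub>0 int) set" where
  "B_symbol A n xs = B_kernel A n #>\<^bsub>free_Abelian_group (symbols A n)\<^esub> frag_of xs"

definition M_symbol ::
    "('a, 'm) monoid_scheme \<Rightarrow> nat \<Rightarrow> 'a list \<Rightarrow> ('a list \<Rightarrow>\<^sub>0 int) set" where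
  "M_symbol A n xs = M_kernel A n #>\<^bsub>free_Abelian_group (symbols A n)\<^esub> frag_of xs"

text \<open>The prescribed values. Zeros need only be considered in leading position, since
  \<open>B_symbol A n xs\<close> is invariant under permutations of \<open>xs\<close>.\<close>

definition mu_on_symbols ::
    "('a, 'm) monoid_scheme \<Rightarrow> nat
      \<Rightarrow> (('a list \<Rightarrow>\<^sub>0 int) set \<Rightarrow> ('a list \<Rightarrow>\<^sub>0 int) set) \<Rightarrow> bool" where
  "mu_on_symbols A n \<mu> \<longleftrightarrow>
     (\<forall>as. as \<in> symbols A n \<and> \<one>\<^bsub>A\<^esub> \<notin> set as \<longrightarrow> \<mu> (B_symbol A n as) = M_symbol A n as) \<and>
     (\<forall>as. \<one>\<^bsub>A\<^esub> # as \<in> symbols A n \<and> \<one>\<^bsub>A\<^esub> \<notin> set as \<longrightarrow>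
        \<mu> (B_symbol A n (\<one>\<^bsub>A\<^esub> # as)) = M_symbol A n (\<one>\<^bsub>A\<^esub> # as) [^]\<^bsub>M_group A n\<^esub> (2::nat)) \<and>
     (\<forall>as. \<one>\<^bsub>A\<^esub> # \<one>\<^bsub>A\<^esub> # as \<in> symbols A n \<longrightarrow>
        \<mu> (B_symbol A n (\<one>\<^bsub>A\<^esub> # \<one>\<^bsub>A\<^esub> # as)) = \<one>\<^bsub>M_group A n\<^esub>)"

end

theory Submission
  imports Defs
begin

text \<open>Relation (M) for the pair \<open>a, 0\<close> reads \<open>\<langle>a, 0, \<dots>\<rangle> = \<langle>a, -a, \<dots>\<rangle> + \<langle>a, 0, \<dots>\<rangle>\<close>, so every symbol
  containing \<open>a\<close> and \<open>-a\<close> vanishes in \<open>M_group\<close>, in particular every symbol with two zero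
  entries. Hence \<open>\<mu>\<close> doubles the symbols that contain a zero entry and fixes the others. If some
  \<open>a\<^sub>p = 0\<close> takes part in relation (B), the \<open>p\<close>-th summand is the left-hand side and all others contain a pair
  \<open>a\<^sub>i, -a\<^sub>i\<close>. Otherwise (B) is mapped to a multiple of (M), whose summands are
  grouped by the value of \<open>a\<^sub>i\<close>. The cokernel is killed by 2 because \<open>2\<langle>x\<rangle>\<close> is \<open>\<mu>\<close> of \<open>[x]\<close> or of
  \<open>2[x]\<close>.\<close>

section \<open>Characters of an abelian group\<close>

lemma comm_group_character_group:
  assumes "comm_group G"
  shows "comm_group (character_group G)"
proof -
  interpret G: comm_group G by (fact assms)
  have hom_iff: "\<chi> \<in> hom G complex_units \<longleftrightarrow>
      (\<forall>x \<in> carrier G. \<chi> x \<noteq> 0) \<and> (\<forall>x \<in> carrier G. \<forall>y \<in> carrier G. \<chi> (x \<otimes>\<^bsub>G\<^esub> y) = \<chi> x * \<chi> y)"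
    for \<chi> by (auto simp: hom_def complex_units_def)
  show ?thesis
  proof (rule comm_groupI)
    fix \<chi> assume "\<chi> \<in> carrier (character_group G)"
    then show "\<exists>\<psi> \<in> carrier (character_group G). \<psi> \<otimes>\<^bsub>character_group G\<^esub> \<chi> = \<one>\<^bsub>character_group G\<^esub>"
      \<comment> \<open>Values of characters are nonzero, so the pointwise inverse is again a
        character; cutting it off outside \<open>carrier G\<close> keeps it extensional.\<close>
      by (intro bexI[of _ "\<lambda>g\<in>carrier G. inverse (\<chi> g)"])
        (auto simp: character_group_def hom_iff fun_eq_iff)
  next
    fix \<chi> assume "\<chi> \<in> carrier (character_group G)"
    then show "\<one>\<^bsub>character_group G\<^esub> \<otimes>\<^bsub>character_group G\<^esub> \<chi> = \<chi>"
      by (auto simp: character_group_def fun_eq_iff extensional_def)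
  qed (auto simp: character_group_def hom_iff fun_eq_iff)
qed

section \<open>Rearrangements and pivots of lists\<close>

lemma mset_nth_pair:
  assumes "i < length xs" and "j < length xs" and "i \<noteq> j"
  obtains ys where "mset xs = mset (xs ! i # xs ! j # ys)"
proof -
  \<comment> \<open>Distinctness is used at the level of positions: mapping \<open>(!) xs\<close>
    over the index pair preserves multiplicity even when the two entries coincide.\<close>
  have "{#i, j#} \<subseteq># mset [0..<length xs]"
    using assms by (intro mset_subset_eqI) (auto simp: count_mset)
  then have "image_mset ((!) xs) {#i, j#} \<subseteq># image_mset ((!) xs) (mset [0..<length xs])"
    by (rule image_mset_subseteq_mono)
  then have "{#xs ! i, xs ! j#} \<subseteq># mset xs"
    by (metis image_mset_add_mset image_mset_empty map_nth mset_map)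
  then obtain N where "mset xs = {#xs ! i, xs ! j#} + N"
    by (auto simp: subset_mset.le_iff_add)
  moreover obtain ys where "mset ys = N"
    using ex_mset by blast
  ultimately show thesis
    using that[of ys] by simp
qed

lemma frag_cmul_diff: "frag_cmul c (x - y) = frag_cmul c x - frag_cmul c y"
  by (metis add_diff_cancel_right' diff_add_cancel frag_cmul_distrib2)

lemma length_pivot [simp]: "length (pivot G as i) = length as"
  by (simp add: pivot_def)

lemma nth_pivot:
  assumes "j < length as"
  shows "pivot G as i ! j = (if j = i then as ! i else as ! j \<otimes>\<^bsub>G\<^esub> inv\<^bsub>G\<^esub> (as ! i))"
  using assms by (auto simp: pivot_def nth_list_update)

text \<open>The list of differences is the same for both pivots, and the entry overwritten at
  \<open>i\<close> or at \<open>j\<close> is in both cases the difference of the common value with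
  itself.\<close>

lemma mset_pivot_cong:
  assumes "i < length as" and "j < length as" and "as ! i = as ! j"
  shows "mset (pivot G as i) = mset (pivot G as j)"
  using assms by (simp add: pivot_def mset_update)

lemma mset_in_symbols:
  assumes "xs \<in> symbols G n" and "mset ys = mset xs"
  shows "ys \<in> symbols G n"
  using assms mset_eq_setD[of ys xs] mset_eq_length[of ys xs] by (auto simp: symbols_def)

section \<open>Generating lists under change of entries\<close>

context comm_group
begin

lemma symbolsI:
  assumes "xs \<in> symbols G n" and "length ys = length xs" and "set ys \<subseteq> carrier G"
    and "set xs \<subseteq> generate G (set ys)"
  shows "ys \<in> symbols G n"
proof -
  have "generate G (set xs) \<subseteq> generate G (set ys)"
    using assms by (intro generate_subgroup_incl generate_is_subgroup)
  moreover have "generate G (set ys) \<subseteq> carrier G"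
    using assms generate_incl by blast
  ultimately show ?thesis
    using assms by (auto simp: symbols_def)
qed

text \<open>Passing to a pivot is reversible: the \<open>i\<close>-th entry is kept, and adding it
  back to the other entries recovers the old generators. Hence the summands of (B) and (M) are
  symbols again.\<close>

lemma pivot_in_symbols:
  assumes xs: "as @ bs \<in> symbols G n" and i: "i < length as"
  shows "pivot G as i @ bs \<in> symbols G n"
proof (rule symbolsI[OF xs])
  have carr: "set as \<subseteq> carrier G" "set bs \<subseteq> carrier G"
    using xs by (auto simp: symbols_def)
  show sub: "set (pivot G as i @ bs) \<subseteq> carrier G"
    using carr i by (auto simp: in_set_conv_nth nth_pivot) (meson inv_closed m_closed nth_mem subsetD)+
  let ?H = "generate G (set (pivot G as i @ bs))"
  have mem: "pivot G as i ! j \<in> ?H" if "j < length as" for j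
    using that by (intro generate.incl) auto
  have "as ! j \<in> ?H" if j: "j < length as" for j
  proof (cases "j = i")
    case True
    then show ?thesis
      using mem[OF i] i by (simp add: nth_pivot)
  next
    case False
    have "as ! j = pivot G as i ! j \<otimes> pivot G as i ! i"
      using False i j carr by (simp add: nth_pivot m_assoc subset_iff)
    then show ?thesis
      using mem[OF i] mem[OF j] generate.eng by metis
  qed
  moreover have "set bs \<subseteq> ?H"
    by (auto intro: generate.incl)
  ultimately show "set (as @ bs) \<subseteq> ?H"
    by (auto simp: in_set_conv_nth)
qed simp

section \<open>The relation subgroups\<close>

lemma S_relators_subset: "S_relators G n \<subseteq> carrier (free_Abelian_group (symbols G n))"
proof
  fix r assume "r \<in> S_relators G n"
  then obtain \<sigma> xs where r: "r = frag_of (permute_list \<sigma> xs) - frag_of xs"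
      and \<sigma>: "\<sigma> permutes {..<n}" and xs: "xs \<in> symbols G n"
    by (auto simp: S_relators_def)
  have "length xs = n"
    using xs by (simp add: symbols_def)
  then have "permute_list \<sigma> xs \<in> symbols G n"
    using mset_in_symbols[OF xs] mset_permute_list[of \<sigma> xs] \<sigma> by simp
  then show "r \<in> carrier (free_Abelian_group (symbols G n))"
    using xs keys_diff[of "frag_of (permute_list \<sigma> xs)" "frag_of xs"] by (auto simp: r)
qed

text \<open>The index set is left open so that the sum over first occurrences in (B) and the sum
  over all indices in (M) are treated together.\<close>

lemma relator_closed:
  assumes "as @ bs \<in> symbols G n" and "\<And>i. i \<in> I \<Longrightarrow> i < length as"
  shows "frag_of (as @ bs) - (\<Sum>i\<in>I. frag_of (pivot G as i @ bs))
     \<in> carrier (free_Abelian_group (symbols G n))"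
proof -
  have "frag_of (pivot G as i @ bs) \<in> carrier (free_Abelian_group (symbols G n))" if "i \<in> I" for i
    using assms that by (simp add: pivot_in_symbols)
  then have "(\<Sum>i\<in>I. frag_of (pivot G as i @ bs)) \<in> carrier (free_Abelian_group (symbols G n))"
    by (rule sum_closed_free_Abelian_group)
  then show ?thesis
    using assms(1) keys_diff[of "frag_of (as @ bs)" "\<Sum>i\<in>I. frag_of (pivot G as i @ bs)"] by auto
qed

lemma subgroup_B_kernel: "subgroup (B_kernel G n) (free_Abelian_group (symbols G n))"
  unfolding B_kernel_def
proof (rule group.generate_is_subgroup[OF group_free_Abelian_group])
  show "S_relators G n \<union> B_relators G n \<subseteq> carrier (free_Abelian_group (symbols G n))"
    using S_relators_subset[of n] unfolding B_relators_def
    by (auto simp del: carrier_free_Abelian_group_iff intro!: relator_closed)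
qed

lemma subgroup_M_kernel: "subgroup (M_kernel G n) (free_Abelian_group (symbols G n))"
  unfolding M_kernel_def
proof (rule group.generate_is_subgroup[OF group_free_Abelian_group])
  show "S_relators G n \<union> M_relators G n \<subseteq> carrier (free_Abelian_group (symbols G n))"
    using S_relators_subset[of n] unfolding M_relators_def
    by (auto simp del: carrier_free_Abelian_group_iff intro!: relator_closed)
qed

section \<open>Additive closure properties of \<open>M_kernel\<close>\<close>

lemma M_kernel_coset:
  assumes "x \<in> M_kernel G n"
  shows "M_kernel G n #>\<^bsub>free_Abelian_group (symbols G n)\<^esub> x = M_kernel G n"
  using assms subgroup.mem_carrier[OF subgroup_M_kernel assms]
  by (intro group.coset_join2[OF group_free_Abelian_group _ subgroup_M_kernel])

lemma M_kernel_zero: "0 \<in> M_kernel G n"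
  using subgroup.one_closed[OF subgroup_M_kernel] by simp

lemma M_kernel_add: "x \<in> M_kernel G n \<Longrightarrow> y \<in> M_kernel G n \<Longrightarrow> x + y \<in> M_kernel G n"
  using subgroup.m_closed[OF subgroup_M_kernel] by fastforce

lemma M_kernel_minus: "x \<in> M_kernel G n \<Longrightarrow> - x \<in> M_kernel G n"
  using subgroup.m_inv_closed[OF subgroup_M_kernel, of x n]
    subgroup.mem_carrier[OF subgroup_M_kernel, of x n] by simp

lemma M_kernel_diff: "x \<in> M_kernel G n \<Longrightarrow> y \<in> M_kernel G n \<Longrightarrow> x - y \<in> M_kernel G n"
  using M_kernel_add[of x n "- y"] M_kernel_minus[of y n] by simp

lemma M_kernel_sum: "(\<And>i. i \<in> I \<Longrightarrow> f i \<in> M_kernel G n) \<Longrightarrow> sum f I \<in> M_kernel G n"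
  by (induction I rule: infinite_finite_induct) (auto intro: M_kernel_zero M_kernel_add)

lemma M_kernel_cmul:
  assumes "x \<in> M_kernel G n"
  shows "frag_cmul c x \<in> M_kernel G n"
proof (induction c rule: int_induct[where k = 0])
  case base
  then show ?case
    by (simp add: M_kernel_zero)
next
  case (step1 i)
  then show ?case
    using assms by (simp add: M_kernel_add frag_cmul_distrib)
next
  case (step2 i)
  then show ?case
    using assms by (simp add: M_kernel_diff frag_cmul_diff_distrib)
qed

text \<open>Lists with equal multisets differ by a permutation of positions. From here on (S) is
  applied through equality of multisets, without naming permutations.\<close>

lemma mset_diff_in_S_relators:
  assumes "xs \<in> symbols G n" and "mset ys = mset xs"
  shows "frag_of ys - frag_of xs \<in> S_relators G n"
proof -
  obtain \<sigma> where "\<sigma> permutes {..<length xs}" and "permute_list \<sigma> xs = ys"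
    using mset_eq_permutation[OF assms(2)] .
  moreover have "length xs = n"
    using assms by (simp add: symbols_def)
  ultimately show ?thesis
    using assms(1) unfolding S_relators_def by blast
qed

lemma mset_diff_in_M_kernel:
  assumes "xs \<in> symbols G n" and "mset ys = mset xs"
  shows "frag_of ys - frag_of xs \<in> M_kernel G n"
  using mset_diff_in_S_relators[OF assms] unfolding M_kernel_def by (blast intro: generate.incl)

lemma mset_mem_M_kernel:
  assumes "xs \<in> symbols G n" and "mset ys = mset xs" and "frag_of ys \<in> M_kernel G n"
  shows "frag_of xs \<in> M_kernel G n"
  using M_kernel_diff[OF assms(3) mset_diff_in_M_kernel[OF assms(1,2)]] by simp

lemma pivot_relation_in_M_kernel:
  assumes "as @ bs \<in> symbols G n" and "2 \<le> length as"
  shows "frag_of (as @ bs) - (\<Sum>i<length as. frag_of (pivot G as i @ bs)) \<in> M_kernel G n"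
  using assms unfolding M_kernel_def M_relators_def by (blast intro: generate.incl)

section \<open>Vanishing symbols\<close>

lemma inverse_pair_in_M_kernel:
  assumes a: "a \<in> carrier G" and xs: "a # inv a # bs \<in> symbols G n"
  shows "frag_of (a # inv a # bs) \<in> M_kernel G n"
proof -
  \<comment> \<open>Replacing \<open>-a\<close> by 0 loses no generators, since \<open>-a\<close>
    lies in the subgroup generated by \<open>a\<close>.\<close>
  have "[a, \<one>] @ bs \<in> symbols G n"
  proof (rule symbolsI[OF xs])
    show "set (a # inv a # bs) \<subseteq> generate G (set ([a, \<one>] @ bs))"
      by (auto intro: generate.incl generate.inv)
  qed (use xs in \<open>auto simp: symbols_def\<close>)
  \<comment> \<open>In additive notation: the pivots of \<open>a, 0\<close> are \<open>a, -a\<close> and \<open>a, 0\<close> itself.\<close>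
  from pivot_relation_in_M_kernel[OF this]
  have "- frag_of (a # inv a # bs) \<in> M_kernel G n"
    using a by (simp add: pivot_def numeral_2_eq_2)
  from M_kernel_minus[OF this] show ?thesis
    by simp
qed

text \<open>By (S) the pair can be moved to the front. Positions are required to differ, not values,
  so the case \<open>a = -a\<close> is included; two zero entries are an instance.\<close>

lemma nth_inverse_in_M_kernel:
  assumes xs: "xs \<in> symbols G n"
    and ij: "i < length xs" "j < length xs" "i \<noteq> j" and inv: "xs ! j = inv (xs ! i)"
  shows "frag_of xs \<in> M_kernel G n"
proof -
  obtain ys where ys: "mset xs = mset (xs ! i # inv (xs ! i) # ys)"
    using mset_nth_pair[OF ij] inv by metis
  have "xs ! i \<in> carrier G"
    using xs ij by (auto simp: symbols_def)
  then show ?thesis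
    using inverse_pair_in_M_kernel mset_in_symbols[OF xs ys[symmetric]] mset_mem_M_kernel[OF xs ys[symmetric]]
    by blast
qed

lemma nth_two_ones_in_M_kernel:
  assumes "xs \<in> symbols G n"
    and "i < length xs" and "j < length xs" and "i \<noteq> j" and "xs ! i = \<one>" and "xs ! j = \<one>"
  shows "frag_of xs \<in> M_kernel G n"
  by (rule nth_inverse_in_M_kernel[of xs n i j]) (simp_all add: assms)

section \<open>The map on free abelian groups\<close>

text \<open>Symbols with two zero entries vanish in \<open>M_group\<close>, so doubling all symbols that contain
  a zero entry realises the three cases at once.\<close>

definition one_weight :: "'a list \<Rightarrow> int" where
  "one_weight xs = (if \<one> \<in> set xs then 2 else 1)"

definition mu_frag :: "('a list \<Rightarrow>\<^sub>0 int) \<Rightarrow> 'a list \<Rightarrow>\<^sub>0 int" where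
  "mu_frag = frag_extend (\<lambda>xs. frag_cmul (one_weight xs) (frag_of xs))"

lemma mu_frag_of [simp]: "mu_frag (frag_of xs) = frag_cmul (one_weight xs) (frag_of xs)"
  by (simp add: mu_frag_def)

lemma mu_frag_zero [simp]: "mu_frag 0 = 0"
  by (simp add: mu_frag_def)

lemma mu_frag_add: "mu_frag (x + y) = mu_frag x + mu_frag y"
  by (simp add: mu_frag_def frag_extend_add)

lemma mu_frag_minus: "mu_frag (- x) = - mu_frag x"
  by (simp add: mu_frag_def frag_extend_minus)

lemma mu_frag_diff: "mu_frag (x - y) = mu_frag x - mu_frag y"
  by (simp add: mu_frag_def frag_extend_diff)

lemma mu_frag_sum: "finite I \<Longrightarrow> mu_frag (sum f I) = (\<Sum>i\<in>I. mu_frag (f i))"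
  by (simp add: mu_frag_def frag_extend_sum comp_def)

lemma mu_frag_closed: "Poly_Mapping.keys x \<subseteq> S \<Longrightarrow> Poly_Mapping.keys (mu_frag x) \<subseteq> S"
  unfolding mu_frag_def
  by (rule order_trans[OF keys_frag_extend]) (auto simp: one_weight_def)

text \<open>The weight depends only on the set of entries, so \<open>mu_frag\<close> merely
  multiplies an (S) relator by a constant.\<close>

lemma mu_frag_S_relator:
  assumes "r \<in> S_relators G n"
  shows "mu_frag r \<in> M_kernel G n"
proof -
  obtain \<sigma> xs where r: "r = frag_of (permute_list \<sigma> xs) - frag_of xs"
      and \<sigma>: "\<sigma> permutes {..<n}" and xs: "xs \<in> symbols G n"
    using assms by (auto simp: S_relators_def)
  have "length xs = n"
    using xs by (simp add: symbols_def)
  then have eq: "mset (permute_list \<sigma> xs) = mset xs"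
    using \<sigma> by simp
  have "one_weight (permute_list \<sigma> xs) = one_weight xs"
    using mset_eq_setD[OF eq] by (simp add: one_weight_def)
  then have "mu_frag r = frag_cmul (one_weight xs) r"
    by (simp add: r mu_frag_diff frag_cmul_diff)
  then show ?thesis
    using M_kernel_cmul mset_diff_in_M_kernel[OF xs eq] by (simp add: r)
qed

section \<open>Zero entries of pivots and the image of relation (B)\<close>

lemma pivot_one:
  assumes "set as \<subseteq> carrier G" and "i < length as" and "as ! i = \<one>"
  shows "pivot G as i = as"
  using assms by (intro nth_equalityI) (auto simp: nth_pivot subset_iff)

text \<open>The zero at position \<open>j\<close> turns into \<open>-a_i\<close> while position
  \<open>i\<close> still holds \<open>a_i\<close>, so the pivot contains a pair of opposite
  entries.\<close>

lemma pivot_inverse_in_M_kernel: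
  assumes "as @ bs \<in> symbols G n" and "i < length as" and "j < length as" and "i \<noteq> j"
    and "as ! j = \<one>"
  shows "frag_of (pivot G as i @ bs) \<in> M_kernel G n"
proof (rule nth_inverse_in_M_kernel[of _ n i j])
  have "as ! i \<in> carrier G"
    using assms by (auto simp: symbols_def)
  then show "(pivot G as i @ bs) ! j = inv ((pivot G as i @ bs) ! i)"
    using assms by (simp add: nth_append nth_pivot)
qed (use assms in \<open>simp_all add: pivot_in_symbols\<close>)

lemma pivot_eq_one:
  assumes "set as \<subseteq> carrier G" and "i < length as" and "j < length as" and "i \<noteq> j"
  shows "pivot G as i ! j = \<one> \<longleftrightarrow> as ! j = as ! i"
proof -
  have "as ! i \<in> carrier G" "as ! j \<in> carrier G"
    using assms by auto
  then show ?thesis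
    using assms by (metis inv_equality inv_inv inv_closed nth_pivot r_inv)
qed

text \<open>If the value \<open>as ! i\<close> occurs \<open>m\<close> times in \<open>as\<close>, then the pivots at its occurrences agree
  in \<open>M_group\<close> and have \<open>m - 1\<close> zero entries: for \<open>m = 2\<close> the two equal terms match the
  weight 2, for \<open>m \<ge> 3\<close> they vanish.\<close>

lemma mu_frag_pivot:
  assumes xs: "as @ bs \<in> symbols G n" and one: "\<one> \<notin> set as" and i: "i < length as"
  shows "mu_frag (frag_of (pivot G as i @ bs))
     - frag_cmul (one_weight (as @ bs)) (\<Sum>j | j < length as \<and> as ! j = as ! i. frag_of (pivot G as j @ bs))
     \<in> M_kernel G n"
proof -
  define T where "T j = frag_of (pivot G as j @ bs)" for j
  define J where "J = {j. j < length as \<and> as ! j = as ! i}"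
  have as: "set as \<subseteq> carrier G"
    using xs by (auto simp: symbols_def)
  have sym: "pivot G as i @ bs \<in> symbols G n"
    using xs i by (rule pivot_in_symbols)
  have T_cong: "T j - T i \<in> M_kernel G n" if "j \<in> J" for j
    using mset_diff_in_M_kernel[OF sym, of "pivot G as j @ bs"] that i mset_pivot_cong[of j as i G]
    by (simp add: T_def J_def)
  have J_one: "pivot G as i ! j = \<one>" if "j \<in> J" "j \<noteq> i" for j
    using that pivot_eq_one[OF as i, of j] by (auto simp: J_def)
  have "finite J" and iJ: "i \<in> J"
    using i by (simp_all add: J_def)
  have "mu_frag (T i) - frag_cmul (one_weight (as @ bs)) (\<Sum>j\<in>J. T j) \<in> M_kernel G n"
  proof (cases "J = {i}")
    case True
    \<comment> \<open>Multiplicity one: no difference is zero and the kept entry is nonzero, so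
      pivoting creates no zero and the weight is unchanged.\<close>
    have "\<one> \<notin> set (pivot G as i)"
    proof
      assume "\<one> \<in> set (pivot G as i)"
      then obtain j where j: "j < length as" "pivot G as i ! j = \<one>"
        by (auto simp: in_set_conv_nth)
      then have "j = i"
        using True pivot_eq_one[OF as i j(1)] by (auto simp: J_def)
      then show False
        using j one nth_mem[OF i] by (auto simp: nth_pivot)
    qed
    then have "one_weight (pivot G as i @ bs) = one_weight (as @ bs)"
      using one by (simp add: one_weight_def)
    then show ?thesis
      using True by (simp add: T_def M_kernel_zero)
  next
    case False
    then obtain j where j: "j \<in> J" "j \<noteq> i"
      using iJ by blast
    then have jl: "j < length as"
      by (simp add: J_def)
    have "\<one> \<in> set (pivot G as i)"
      using nth_mem[of j "pivot G as i"] jl J_one[OF j] by simp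
    then have weight: "mu_frag (T i) = frag_cmul 2 (T i)"
      by (simp add: T_def one_weight_def)
    show ?thesis
    \<comment> \<open>If \<open>T i\<close> vanishes in \<open>M_group\<close>, so do all terms of
      its class, whatever the weights. Otherwise the zero at \<open>j\<close> is the only one in the
      pivot symbol, so \<open>bs\<close> contains no zero and the multiplicity is exactly
      two.\<close>
    proof (cases "T i \<in> M_kernel G n")
      case True
      then have "T k \<in> M_kernel G n" if "k \<in> J" for k
        using M_kernel_add[OF T_cong[OF that] True] by simp
      then show ?thesis
        unfolding weight using True by (intro M_kernel_diff M_kernel_cmul M_kernel_sum)
    next
      case no: False
      have pair: False if "k < length (as @ bs)" "k \<noteq> j" "(pivot G as i @ bs) ! k = \<one>" for k
        using no nth_two_ones_in_M_kernel[OF sym, of k j] that jl J_one[OF j]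
        by (simp add: T_def nth_append)
      have "\<one> \<notin> set bs"
      proof
        assume "\<one> \<in> set bs"
        then obtain p where "p < length bs" "bs ! p = \<one>"
          by (auto simp: in_set_conv_nth)
        then show False
          using pair[of "length as + p"] jl by (simp add: nth_append)
      qed
      moreover have "k = i \<or> k = j" if "k \<in> J" for k
        using pair[of k] J_one[of k] that by (auto simp: J_def nth_append)
      then have "J = {i, j}"
        using iJ j by blast
      \<comment> \<open>Here \<open>one_weight (as @ bs)\<close> is 1, so the expression is
        \<open>2 T i - (T i + T j)\<close>.\<close>
      ultimately have "mu_frag (T i) - frag_cmul (one_weight (as @ bs)) (\<Sum>j\<in>J. T j) = - (T j - T i)"
        using j one frag_cmul_distrib[of 1 1 "T i"] by (simp add: weight one_weight_def)
      then show ?thesis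
        using M_kernel_minus[OF T_cong[OF j(1)]] by simp
    qed
  qed
  then show ?thesis
    by (simp add: T_def J_def)
qed

lemma mu_frag_B_relator:
  assumes "r \<in> B_relators G n"
  shows "mu_frag r \<in> M_kernel G n"
proof -
  define F where "F as = {i. i < length as \<and> (\<forall>i'<i. as ! i \<noteq> as ! i')}" for as :: "'a list"
  obtain as bs where r: "r = frag_of (as @ bs) - (\<Sum>i\<in>F as. frag_of (pivot G as i @ bs))"
      and len: "2 \<le> length as" and xs: "as @ bs \<in> symbols G n"
    using assms by (auto simp: B_relators_def F_def)
  define T where "T i = frag_of (pivot G as i @ bs)" for i
  have as: "set as \<subseteq> carrier G"
    using xs by (auto simp: symbols_def)
  have fin: "finite (F as)"
    by (simp add: F_def)
  \<comment> \<open>\<open>g\<close> sends a position to the first one with the same value; its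
    fibres over \<open>F as\<close> are the classes of equal entries. The \<open>LEAST\<close>
    ranges over all naturals, but \<open>g i \<le> i\<close> keeps it inside the list.\<close>
  define g where "g i = (LEAST j. as ! j = as ! i)" for i
  have nth_g: "as ! g i = as ! i" for i
    unfolding g_def by (rule LeastI) (rule refl)
  have g_cong: "g j = g i" if "as ! j = as ! i" for i j
    unfolding g_def that by (rule refl)
  have first: "g i \<in> F as" if "i < length as" for i
  proof -
    have "as ! i' \<noteq> as ! g i" if "i' < g i" for i'
      unfolding nth_g using that unfolding g_def by (rule not_less_Least)
    moreover have "g i \<le> i"
      unfolding g_def by (rule Least_le) (rule refl)
    ultimately show ?thesis
      unfolding F_def using that by (simp add: eq_commute)
  qed
  have g_first: "g i = i" if "i \<in> F as" for i
    using that unfolding F_def g_def by (intro Least_equality) (auto simp flip: not_less)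
  have mu_r: "mu_frag r = mu_frag (frag_of (as @ bs)) - (\<Sum>i\<in>F as. mu_frag (T i))"
    using fin by (simp add: r T_def mu_frag_diff mu_frag_sum del: mu_frag_of)
  show ?thesis
  proof (cases "\<one> \<in> set as")
    case True
    then obtain q where q: "q < length as" "as ! q = \<one>"
      by (auto simp: in_set_conv_nth)
    \<comment> \<open>Only first occurrences are summed in (B), so the first zero is taken.\<close>
    define p where "p = g q"
    have p: "p \<in> F as" "p < length as" "as ! p = \<one>"
      using first[OF q(1)] nth_g[of q] q(2) unfolding p_def F_def by auto
    \<comment> \<open>The pivot at a zero entry is the symbol itself, so both sides have the same weight.\<close>
    have "mu_frag r = - (\<Sum>i\<in>F as - {p}. mu_frag (T i))"
      using p(1) fin by (simp add: mu_r sum.remove[of _ p] T_def pivot_one[OF as p(2,3)] del: mu_frag_of)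
    moreover have "mu_frag (T i) \<in> M_kernel G n" if "i \<in> F as - {p}" for i
      using that pivot_inverse_in_M_kernel[OF xs, of i p] p by (simp add: T_def F_def M_kernel_cmul)
    ultimately show ?thesis
      by (metis M_kernel_minus M_kernel_sum)
  next
    case False
    define J where "J i = {j. j < length as \<and> as ! j = as ! i}" for i
    have J: "{j \<in> {..<length as}. g j = i} = J i" if "i \<in> F as" for i
    proof -
      have "g j = i \<longleftrightarrow> as ! j = as ! i" for j
        using nth_g g_cong g_first[OF that] by metis
      then show ?thesis
        unfolding J_def by blast
    qed
    \<comment> \<open>The sum in (M) is split into classes of equal entries, one for each summand of
      (B).\<close>
    have "(\<Sum>j<length as. T j) = (\<Sum>i\<in>F as. sum T {j \<in> {..<length as}. g j = i})"
      using fin first by (intro sum.group[symmetric]) auto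
    also have "\<dots> = (\<Sum>i\<in>F as. sum T (J i))"
      using J by simp
    finally have "(\<Sum>i\<in>F as. mu_frag (T i) - frag_cmul (one_weight (as @ bs)) (sum T (J i)))
        = (\<Sum>i\<in>F as. mu_frag (T i)) - frag_cmul (one_weight (as @ bs)) (\<Sum>j<length as. T j)"
      by (simp add: sum_subtractf frag_cmul_sum)
    \<comment> \<open>The image is the weighted (M) relator minus one defect for each class;
      \<open>mu_frag_pivot\<close> puts every defect in \<open>M_kernel\<close>.\<close>
    then have "mu_frag r = frag_cmul (one_weight (as @ bs)) (frag_of (as @ bs) - (\<Sum>j<length as. T j))
        - (\<Sum>i\<in>F as. mu_frag (T i) - frag_cmul (one_weight (as @ bs)) (sum T (J i)))"
      by (simp add: mu_r frag_cmul_diff)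
    moreover have "frag_of (as @ bs) - (\<Sum>j<length as. T j) \<in> M_kernel G n"
      using pivot_relation_in_M_kernel[OF xs len] by (simp add: T_def)
    moreover have "mu_frag (T i) - frag_cmul (one_weight (as @ bs)) (sum T (J i)) \<in> M_kernel G n"
      if "i \<in> F as" for i
      using mu_frag_pivot[OF xs False, of i] that unfolding T_def J_def F_def by blast
    ultimately show ?thesis
      by (simp add: M_kernel_diff M_kernel_cmul M_kernel_sum)
  qed
qed

lemma mu_frag_B_kernel:
  assumes "x \<in> B_kernel G n"
  shows "mu_frag x \<in> M_kernel G n"
proof -
  let ?F = "free_Abelian_group (symbols G n)"
  have rel: "mu_frag r \<in> M_kernel G n" if "r \<in> S_relators G n \<union> B_relators G n" for r
    using that mu_frag_S_relator mu_frag_B_relator by blast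
  have sub: "S_relators G n \<union> B_relators G n \<subseteq> carrier ?F"
    using subgroup_B_kernel[of n] generate.incl[of _ "S_relators G n \<union> B_relators G n" ?F]
    unfolding B_kernel_def by (meson subgroup.subset subsetD subsetI)
  show ?thesis
    using assms unfolding B_kernel_def
  proof (induction rule: generate.induct)
    case (inv r)
    \<comment> \<open>The group inverse is identified with negation on the carrier of
      \<open>?F\<close>, hence the appeal to \<open>sub\<close>.\<close>
    then have "inv\<^bsub>?F\<^esub> r = - r"
      using sub by auto
    then show ?case
      using rel[OF inv] by (simp add: mu_frag_minus M_kernel_minus)
  qed (simp_all add: M_kernel_zero M_kernel_add mu_frag_add rel)
qed

section \<open>Passage to the quotients\<close>

lemma free_Abelian_coset_eq_iff:
  assumes H: "subgroup H (free_Abelian_group S)"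
    and x: "Poly_Mapping.keys x \<subseteq> S" and y: "Poly_Mapping.keys y \<subseteq> S"
  shows "H #>\<^bsub>free_Abelian_group S\<^esub> x = H #>\<^bsub>free_Abelian_group S\<^esub> y \<longleftrightarrow> x - y \<in> H"
proof -
  let ?F = "free_Abelian_group S"
  have "x \<in> H #>\<^bsub>?F\<^esub> y \<longleftrightarrow> x - y \<in> H"
    using subgroup.rcos_module[OF H group_free_Abelian_group, of y x] x y by simp
  moreover have "x \<in> H #>\<^bsub>?F\<^esub> y \<longleftrightarrow> H #>\<^bsub>?F\<^esub> x = H #>\<^bsub>?F\<^esub> y"
    using group.repr_independence[OF group_free_Abelian_group _ _ H, of x y]
      group.rcos_self[OF group_free_Abelian_group _ H, of x] x y by auto
  ultimately show ?thesis
    by simp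
qed

lemma normal_B_kernel: "B_kernel G n \<lhd> free_Abelian_group (symbols G n)"
  by (simp add: comm_group.normal_iff_subgroup[OF abelian_free_Abelian_group] subgroup_B_kernel)

lemma normal_M_kernel: "M_kernel G n \<lhd> free_Abelian_group (symbols G n)"
  by (simp add: comm_group.normal_iff_subgroup[OF abelian_free_Abelian_group] subgroup_M_kernel)

lemma group_B_group: "group (B_group G n)"
  unfolding B_group_def by (rule normal.factorgroup_is_group[OF normal_B_kernel])

lemma comm_group_M_group: "comm_group (M_group G n)"
  unfolding M_group_def
  by (rule comm_group.abelian_FactGroup[OF abelian_free_Abelian_group subgroup_M_kernel])

lemma mu_frag_coset_hom:
  "(\<lambda>x. M_kernel G n #>\<^bsub>free_Abelian_group (symbols G n)\<^esub> mu_frag x)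
     \<in> hom (free_Abelian_group (symbols G n)) (M_group G n)"
proof -
  let ?F = "free_Abelian_group (symbols G n)"
  have "mu_frag \<in> hom ?F ?F"
    by (rule homI) (simp_all add: mu_frag_closed mu_frag_add)
  from Group.hom_compose[OF this normal.r_coset_hom_Mod[OF normal_M_kernel]]
  show ?thesis
    by (simp add: comp_def M_group_def)
qed

section \<open>Prescribed values on symbols and uniqueness\<close>

lemma mu_frag_value_on_symbols:
  assumes \<nu>: "mu_on_symbols G n \<nu>" and xs: "xs \<in> symbols G n"
  shows "\<nu> (B_symbol G n xs)
    = M_kernel G n #>\<^bsub>free_Abelian_group (symbols G n)\<^esub> frag_cmul (one_weight xs) (frag_of xs)"
proof -
  let ?F = "free_Abelian_group (symbols G n)"
  have double: "M_symbol G n ys [^]\<^bsub>M_group G n\<^esub> (2::nat) = M_kernel G n #>\<^bsub>?F\<^esub> frag_cmul 2 (frag_of ys)"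
    if "ys \<in> symbols G n" for ys
    using normal.FactGroup_pow[OF normal_M_kernel, of "frag_of ys" n "2::nat"] that
    by (simp add: M_symbol_def M_group_def)
  \<comment> \<open>Values are prescribed only with zeros in front. This carries them from a
    reordering \<open>ys\<close> to \<open>xs\<close>: both give the same coset of
    \<open>B_kernel\<close>, and (S) also identifies the targets.\<close>
  have perm: "\<nu> (B_symbol G n xs)
      = M_kernel G n #>\<^bsub>?F\<^esub> frag_cmul (one_weight xs) (frag_of xs)"
    if "mset ys = mset xs"
      and "\<nu> (B_symbol G n ys) = M_kernel G n #>\<^bsub>?F\<^esub> frag_cmul (one_weight xs) (frag_of ys)" for ys
  proof -
    have ys: "ys \<in> symbols G n"
      using xs that(1) by (rule mset_in_symbols)
    have "frag_of ys - frag_of xs \<in> B_kernel G n"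
      using mset_diff_in_S_relators[OF xs that(1)] unfolding B_kernel_def by (blast intro: generate.incl)
    then have "B_symbol G n ys = B_symbol G n xs"
      unfolding B_symbol_def using xs ys by (simp add: free_Abelian_coset_eq_iff subgroup_B_kernel)
    moreover have "frag_cmul c (frag_of ys) - frag_cmul c (frag_of xs) \<in> M_kernel G n" for c
      using M_kernel_cmul[OF mset_diff_in_M_kernel[OF xs that(1)]] by (simp add: frag_cmul_diff)
    then have "M_kernel G n #>\<^bsub>?F\<^esub> frag_cmul (one_weight xs) (frag_of ys)
        = M_kernel G n #>\<^bsub>?F\<^esub> frag_cmul (one_weight xs) (frag_of xs)"
      using xs ys by (subst free_Abelian_coset_eq_iff[OF subgroup_M_kernel]) (auto simp: one_weight_def)
    ultimately show ?thesis
      using that(2) by simp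
  qed
  show ?thesis
  proof (cases "\<one> \<in> set xs")
    case False
    then show ?thesis
      using \<nu> xs by (simp add: mu_on_symbols_def M_symbol_def one_weight_def)
  next
    case True
    then obtain us vs where split: "xs = us @ \<one> # vs"
      by (meson split_list)
    have weight: "one_weight xs = 2"
      using True by (simp add: one_weight_def)
    show ?thesis
    proof (cases "\<one> \<in> set (us @ vs)")
      case False
      have eq: "mset (\<one> # us @ vs) = mset xs"
        by (simp add: split)
      have "\<one> # us @ vs \<in> symbols G n"
        using xs eq by (rule mset_in_symbols)
      then have "\<nu> (B_symbol G n (\<one> # us @ vs)) = M_symbol G n (\<one> # us @ vs) [^]\<^bsub>M_group G n\<^esub> (2::nat)"
        using \<nu> False by (simp add: mu_on_symbols_def)
      then show ?thesis
        using \<open>\<one> # us @ vs \<in> symbols G n\<close> by (intro perm[OF eq]) (simp add: double weight)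
    next
      case True
      then obtain us' vs' where split': "us @ vs = us' @ \<one> # vs'"
        by (meson split_list)
      have "mset xs = add_mset \<one> (mset (us @ vs))"
        by (simp add: split)
      then have eq: "mset (\<one> # \<one> # us' @ vs') = mset xs"
        unfolding split' by simp
      have sym: "\<one> # \<one> # us' @ vs' \<in> symbols G n"
        using xs eq by (rule mset_in_symbols)
      \<comment> \<open>With two zeros the prescribed value is trivial, and the doubled symbol is
        trivial as well because the symbol itself vanishes.\<close>
      have "frag_cmul 2 (frag_of (\<one> # \<one> # us' @ vs')) \<in> M_kernel G n"
        using nth_two_ones_in_M_kernel[OF sym, of 0 1] by (intro M_kernel_cmul) simp
      then have "M_kernel G n #>\<^bsub>?F\<^esub> frag_cmul 2 (frag_of (\<one> # \<one> # us' @ vs')) = M_kernel G n"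
        by (rule M_kernel_coset)
      moreover have "\<nu> (B_symbol G n (\<one> # \<one> # us' @ vs')) = M_kernel G n"
        using \<nu> sym by (simp add: mu_on_symbols_def M_group_def)
      ultimately show ?thesis
        by (intro perm[OF eq]) (simp add: weight)
    qed
  qed
qed

text \<open>With at most one zero the weight is the prescribed multiple; with two zeros the target
  symbol already vanishes, so doubling it gives the prescribed trivial value.\<close>

lemma mu_on_symbols_mu_frag:
  assumes "\<And>x. x \<in> carrier (free_Abelian_group (symbols G n)) \<Longrightarrow>
      \<mu> (B_kernel G n #>\<^bsub>free_Abelian_group (symbols G n)\<^esub> x)
        = M_kernel G n #>\<^bsub>free_Abelian_group (symbols G n)\<^esub> mu_frag x"
  shows "mu_on_symbols G n \<mu>"
proof -
  let ?F = "free_Abelian_group (symbols G n)"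
  have val: "\<mu> (B_symbol G n xs) = M_kernel G n #>\<^bsub>?F\<^esub> frag_cmul (one_weight xs) (frag_of xs)"
    if "xs \<in> symbols G n" for xs
    using assms[of "frag_of xs"] that by (simp add: B_symbol_def)
  show ?thesis
    unfolding mu_on_symbols_def
  proof (intro conjI allI impI)
    fix as assume "as \<in> symbols G n \<and> \<one> \<notin> set as"
    then show "\<mu> (B_symbol G n as) = M_symbol G n as"
      by (simp add: val one_weight_def M_symbol_def)
  next
    fix as assume as: "\<one> # as \<in> symbols G n \<and> \<one> \<notin> set as"
    then show "\<mu> (B_symbol G n (\<one> # as)) = M_symbol G n (\<one> # as) [^]\<^bsub>M_group G n\<^esub> (2::nat)"
      using normal.FactGroup_pow[OF normal_M_kernel, of "frag_of (\<one> # as)" n "2::nat"]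
      by (simp add: val one_weight_def M_symbol_def M_group_def)
  next
    fix as assume sym: "\<one> # \<one> # as \<in> symbols G n"
    have "frag_cmul 2 (frag_of (\<one> # \<one> # as)) \<in> M_kernel G n"
      using nth_two_ones_in_M_kernel[OF sym, of 0 1] by (intro M_kernel_cmul) simp
    then have "M_kernel G n #>\<^bsub>?F\<^esub> frag_cmul 2 (frag_of (\<one> # \<one> # as)) = M_kernel G n"
      by (rule M_kernel_coset)
    then show "\<mu> (B_symbol G n (\<one> # \<one> # as)) = \<one>\<^bsub>M_group G n\<^esub>"
      using sym by (simp add: val one_weight_def M_group_def)
  qed
qed

text \<open>Both sides are homomorphisms in \<open>x\<close> on the free abelian group and agree on
  its generators. Since every element of \<open>B_group\<close> is such a coset, this yields
  uniqueness of \<open>\<mu>\<close>.\<close>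

lemma hom_eq_mu_frag:
  assumes \<nu>: "\<nu> \<in> hom (B_group G n) (M_group G n)" and sym: "mu_on_symbols G n \<nu>"
    and x: "x \<in> carrier (free_Abelian_group (symbols G n))"
  shows "\<nu> (B_kernel G n #>\<^bsub>free_Abelian_group (symbols G n)\<^esub> x)
        = M_kernel G n #>\<^bsub>free_Abelian_group (symbols G n)\<^esub> mu_frag x"
proof -
  let ?F = "free_Abelian_group (symbols G n)"
  define p where "p = \<nu> \<circ> (\<lambda>x. B_kernel G n #>\<^bsub>?F\<^esub> x)"
  define q where "q x = M_kernel G n #>\<^bsub>?F\<^esub> mu_frag x" for x
  have "p \<in> hom ?F (M_group G n)"
    unfolding p_def using \<nu> normal.r_coset_hom_Mod[OF normal_B_kernel, of n]
    by (intro Group.hom_compose[of _ _ "B_group G n"]) (simp_all add: B_group_def)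
  then interpret p: group_hom ?F "M_group G n" p
    using comm_group_M_group by (simp add: group_hom_def group_hom_axioms_def comm_group_def)
  have "q \<in> hom ?F (M_group G n)"
    unfolding q_def by (rule mu_frag_coset_hom)
  then interpret q: group_hom ?F "M_group G n" q
    using comm_group_M_group by (simp add: group_hom_def group_hom_axioms_def comm_group_def)
  have "p x = q x"
  proof (rule free_Abelian_group_induct[of x "symbols G n"])
    show "Poly_Mapping.keys x \<subseteq> symbols G n"
      using x by simp
    show "p 0 = q 0"
      using p.hom_one q.hom_one by simp
    show "p (frag_of xs) = q (frag_of xs)" if "xs \<in> symbols G n" for xs
      using mu_frag_value_on_symbols[OF sym that] by (simp add: p_def q_def B_symbol_def)
    show "p (u - v) = q (u - v)"
      if "Poly_Mapping.keys u \<subseteq> symbols G n" "Poly_Mapping.keys v \<subseteq> symbols G n" "p u = q u" "p v = q v"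
      for u v
      using that p.hom_mult[of u "- v"] q.hom_mult[of u "- v"] p.hom_inv[of v] q.hom_inv[of v] by simp
  qed
  then show ?thesis
    by (simp add: p_def q_def)
qed

section \<open>The homomorphism \<open>\<mu>\<close> and its cokernel\<close>

theorem symbol_comparison_hom:
  "\<exists>\<mu> \<in> hom (B_group G n) (M_group G n).
     mu_on_symbols G n \<mu> \<and>
     (\<forall>\<nu> \<in> hom (B_group G n) (M_group G n).
        mu_on_symbols G n \<nu> \<longrightarrow> (\<forall>x \<in> carrier (B_group G n). \<nu> x = \<mu> x)) \<and>
     (\<forall>c \<in> carrier (M_group G n Mod \<mu> ` carrier (B_group G n)).
        c [^]\<^bsub>M_group G n Mod \<mu> ` carrier (B_group G n)\<^esub> (2::nat)
          = \<one>\<^bsub>M_group G n Mod \<mu> ` carrier (B_group G n)\<^esub>)"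
proof -
  let ?F = "free_Abelian_group (symbols G n)" and ?B = "B_group G n" and ?M = "M_group G n"
  interpret M: comm_group ?M
    by (rule comm_group_M_group)
  \<comment> \<open>Since \<open>mu_frag\<close> maps \<open>B_kernel\<close> into
    \<open>M_kernel\<close>, its class is constant on cosets of \<open>B_kernel\<close> and descends
    to the quotient.\<close>
  have "M_kernel G n #>\<^bsub>?F\<^esub> mu_frag x = M_kernel G n #>\<^bsub>?F\<^esub> mu_frag y"
    if "x \<in> carrier ?F" "y \<in> carrier ?F" "B_kernel G n #>\<^bsub>?F\<^esub> x = B_kernel G n #>\<^bsub>?F\<^esub> y" for x y
    using that mu_frag_B_kernel[of "x - y" n]
    by (simp add: free_Abelian_coset_eq_iff subgroup_B_kernel subgroup_M_kernel mu_frag_closed mu_frag_diff)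
  from FactGroup_universal[OF mu_frag_coset_hom normal_B_kernel this]
  obtain \<mu> where \<mu>: "\<mu> \<in> hom ?B ?M"
      and \<mu>_coset: "\<And>x. x \<in> carrier ?F \<Longrightarrow> \<mu> (B_kernel G n #>\<^bsub>?F\<^esub> x) = M_kernel G n #>\<^bsub>?F\<^esub> mu_frag x"
    unfolding B_group_def by blast
  have carrier_B: "carrier ?B = (\<lambda>x. B_kernel G n #>\<^bsub>?F\<^esub> x) ` carrier ?F"
    by (simp add: B_group_def carrier_FactGroup)
  have carrier_M: "carrier ?M = (\<lambda>x. M_kernel G n #>\<^bsub>?F\<^esub> x) ` carrier ?F"
    by (simp add: M_group_def carrier_FactGroup)
  let ?I = "\<mu> ` carrier ?B"
  have I: "subgroup ?I ?M"
    using \<mu> group_B_group by (intro group_hom.img_is_subgroup) (simp add: group_hom_def group_hom_axioms_def)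
  have square: "m [^]\<^bsub>?M\<^esub> (2::nat) \<in> ?I" if mM: "m \<in> carrier ?M" for m
  proof -
    obtain x where x: "x \<in> carrier ?F" and m: "m = M_kernel G n #>\<^bsub>?F\<^esub> x"
      using mM unfolding carrier_M by blast
    \<comment> \<open>The complementary weights, with product 2.\<close>
    define y where "y = frag_extend (\<lambda>xs. frag_cmul (3 - one_weight xs) (frag_of xs)) x"
    have "Poly_Mapping.keys y \<subseteq> Poly_Mapping.keys x"
      unfolding y_def by (rule order_trans[OF keys_frag_extend]) (auto simp: one_weight_def)
    then have y: "y \<in> carrier ?F"
      using x by auto
    have "mu_frag y = frag_cmul 2 x"
      unfolding y_def using x[unfolded carrier_free_Abelian_group_iff]
    proof (rule free_Abelian_group_induct)
      show "mu_frag (frag_extend (\<lambda>xs. frag_cmul (3 - one_weight xs) (frag_of xs)) (frag_of a))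
          = frag_cmul 2 (frag_of a)" for a
        by (simp add: mu_frag_def frag_extend_cmul one_weight_def)
    qed (simp_all add: frag_extend_diff mu_frag_diff frag_cmul_diff)
    moreover have "m [^]\<^bsub>?M\<^esub> (2::nat) = M_kernel G n #>\<^bsub>?F\<^esub> frag_cmul 2 x"
      using normal.FactGroup_pow[OF normal_M_kernel x, of "2::nat"] by (simp add: m M_group_def)
    ultimately have "m [^]\<^bsub>?M\<^esub> (2::nat) = \<mu> (B_kernel G n #>\<^bsub>?F\<^esub> y)"
      using \<mu>_coset[OF y] by simp
    then show ?thesis
      using y by (auto simp: carrier_B)
  qed
  have "c [^]\<^bsub>?M Mod ?I\<^esub> (2::nat) = \<one>\<^bsub>?M Mod ?I\<^esub>" if c: "c \<in> carrier (?M Mod ?I)" for c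
  proof -
    obtain m where m: "m \<in> carrier ?M" "c = ?I #>\<^bsub>?M\<^esub> m"
      using c by (auto simp: carrier_FactGroup)
    have "c [^]\<^bsub>?M Mod ?I\<^esub> (2::nat) = ?I #>\<^bsub>?M\<^esub> (m [^]\<^bsub>?M\<^esub> (2::nat))"
      unfolding m(2) using I m(1) by (intro normal.FactGroup_pow) (simp_all add: M.normal_iff_subgroup)
    also have "\<dots> = ?I"
      using I m(1) square by (intro M.coset_join2) simp_all
    finally show ?thesis
      by simp
  qed
  moreover have "\<nu> z = \<mu> z" if "\<nu> \<in> hom ?B ?M" "mu_on_symbols G n \<nu>" "z \<in> carrier ?B" for \<nu> z
    using that hom_eq_mu_frag[OF that(1,2)] \<mu>_coset by (auto simp: carrier_B)
  moreover have "mu_on_symbols G n \<mu>"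
    using \<mu>_coset by (rule mu_on_symbols_mu_frag)
  ultimately show ?thesis
    using \<mu> by blast
qed

end

section \<open>Specialization to the character group\<close>

theorem theorem4:
  fixes G :: "('g, 'm) monoid_scheme" and n :: nat
  defines "A \<equiv> character_group G"
  defines "B \<equiv> B_group A n" and "M \<equiv> M_group A n"
  assumes "comm_group G" and "finite (carrier G)" and "2 \<le> n"
  shows "\<exists>\<mu> \<in> hom B M.
           mu_on_symbols A n \<mu> \<and>
           (\<forall>\<nu> \<in> hom B M. mu_on_symbols A n \<nu> \<longrightarrow> (\<forall>x \<in> carrier B. \<nu> x = \<mu> x)) \<and>
           (\<forall>c \<in> carrier (M Mod \<mu> ` carrier B).
              c [^]\<^bsub>M Mod \<mu> ` carrier B\<^esub> (2::nat) = \<one>\<^bsub>M Mod \<mu> ` carrier B\<^esub>)"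
  unfolding A_def B_def M_def
  by (intro comm_group.symbol_comparison_hom comm_group_character_group) (rule \<open>comm_group G\<close>)

end
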